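(* Let $\Phi_1$ and $\Phi_2$ be two $\mathcal{C}^1$ convex growth functions with $\Phi_2\in\mathscr{U}$, and let $\alpha,\beta>-1$. Assume that $\Phi_1$ satisfies the $\nabla_2$-condition and that $\frac{\Phi_2}{\Phi_1}$ is nondecreasing. Then the Bergman–Orlicz space $A_\alpha^{\Phi_1}(\mathbb{C}_+)$ embeds continuously into the Bergman–Orlicz space $A_\beta^{\Phi_2}(\mathbb{C}_+)$ if and only if there exists a constant $C>0$ such that for any $t\in (0,\infty)$, $$\Phi_1^{-1}(t^{2+\alpha})\leq \Phi_2^{-1}(Ct^{2+\beta}).$$
   Context: $\mathbb{C}_+=\{x+iy: y>0\}$. A growth function is a continuous nondecreasing function from $[0,\infty)$ onto $[0,\infty)$; $\Phi^{-1}$ is its inverse. $\mathscr{U}^q$ ($q\ge1$) is the set of growth functions $\Phi$ with $\Phi(st)\le Ct^q\Phi(s)$ for $s>0,t\ge1$ and $t\mapsto\Phi(t)/t$ nondecreasing; $\mathscr{U}=\bigcup_{q\ge1}\mathscr{U}^q$. A convex $\Phi$ satisfies the $\nabla_2$-condition if both $\Phi$ and its complementary function $\Psi(s)=\sup_{t\ge0}\{ts-\Phi(t)\}$ satisfy the $\Delta_2$-condition ($F(2t)\le KF(t)$ for some $K>1$, all $t\ge0$). For $\gamma>-1$, $dV_\gamma(x+iy)=y^\gamma dxdy$, and $A^\Phi_\gamma(\mathbb{C}_+)$ is the space of holomorphic $f$ with $\int\Phi(|f|)dV_\gamma<\infty$, normed by $\|f\|^{lux}_{\Phi,\gamma}=\inf\{\lambda>0:\int_{\mathbb{C}_+}\Phi(|f|/\lambda)dV_\gamma\le1\}$.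 Continuous embedding means inclusion with $\|f\|^{lux}_{\Phi_2,\beta}\le C'\|f\|^{lux}_{\Phi_1,\alpha}$. *)

theory Defs
  imports "HOL-Analysis.Analysis"
begin

definition growth_function :: "(real \<Rightarrow> real) \<Rightarrow> bool" where
  "growth_function \<Phi> \<longleftrightarrow> continuous_on {0..} \<Phi> \<and> mono_on {0..} \<Phi> \<and> \<Phi> ` {0..} = {0..}"

definition gf_inv :: "(real \<Rightarrow> real) \<Rightarrow> real \<Rightarrow> real" where
  "gf_inv \<Phi> = the_inv_into {0..} \<Phi>"

definition C1_on_nonneg :: "(real \<Rightarrow> real) \<Rightarrow> bool" where
  "C1_on_nonneg \<Phi> \<longleftrightarrow> (\<exists>\<Phi>'. (\<forall>t\<ge>0. (\<Phi> has_real_derivative \<Phi>' t) (at t within {0..}))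
                            \<and> continuous_on {0..} \<Phi>')"

definition U_class :: "real \<Rightarrow> (real \<Rightarrow> real) \<Rightarrow> bool" where
  "U_class q \<Phi> \<longleftrightarrow> growth_function \<Phi> \<and>
     (\<exists>C. \<forall>s>0. \<forall>t\<ge>1. \<Phi> (s * t) \<le> C * t powr q * \<Phi> s) \<and>
     mono_on {0<..} (\<lambda>t. \<Phi> t / t)"

definition U_union :: "(real \<Rightarrow> real) \<Rightarrow> bool" where
  "U_union \<Phi> \<longleftrightarrow> (\<exists>q\<ge>1. U_class q \<Phi>)"

definition complementary :: "(real \<Rightarrow> real) \<Rightarrow> real \<Rightarrow> ereal" where
  "complementary \<Phi> s = (SUP t\<in>{0..}. ereal (t * s - \<Phi> t))"

definition Delta2 :: "(real \<Rightarrow> ereal) \<Rightarrow> bool" where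
  "Delta2 F \<longleftrightarrow> (\<exists>K>1. \<forall>t\<ge>0. F (2 * t) \<le> ereal K * F t)"

definition nabla2 :: "(real \<Rightarrow> real) \<Rightarrow> bool" where
  "nabla2 \<Phi> \<longleftrightarrow> Delta2 (\<lambda>t. ereal (\<Phi> t)) \<and> Delta2 (complementary \<Phi>)"

definition upper_half :: "complex set" where
  "upper_half = {z. Im z > 0}"

definition V :: "real \<Rightarrow> complex measure" where
  "V \<gamma> = density lborel (\<lambda>z. if Im z > 0 then ennreal (Im z powr \<gamma>) else 0)"

definition orlicz_int :: "(real \<Rightarrow> real) \<Rightarrow> real \<Rightarrow> (complex \<Rightarrow> complex) \<Rightarrow> ennreal" where
  "orlicz_int \<Phi> \<gamma> f = (\<integral>\<^sup>+ z. ennreal (\<Phi> (cmod (f z))) \<partial>(V \<gamma>))"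

definition bergman_orlicz :: "(real \<Rightarrow> real) \<Rightarrow> real \<Rightarrow> (complex \<Rightarrow> complex) set" where
  "bergman_orlicz \<Phi> \<gamma> = {f. f holomorphic_on upper_half \<and> orlicz_int \<Phi> \<gamma> f < \<infinity>}"

definition lux_norm :: "(real \<Rightarrow> real) \<Rightarrow> real \<Rightarrow> (complex \<Rightarrow> complex) \<Rightarrow> real" where
  "lux_norm \<Phi> \<gamma> f = Inf {r. r > 0 \<and> orlicz_int \<Phi> \<gamma> (\<lambda>z. f z / complex_of_real r) \<le> 1}"

definition cont_embeds :: "(real \<Rightarrow> real) \<Rightarrow> real \<Rightarrow> (real \<Rightarrow> real) \<Rightarrow> real \<Rightarrow> bool" where
  "cont_embeds \<Phi>1 \<alpha> \<Phi>2 \<beta> \<longleftrightarrow> bergman_orlicz \<Phi>1 \<alpha> \<subseteq> bergman_orlicz \<Phi>2 \<beta> \<and>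
     (\<exists>C'. \<forall>f\<in>bergman_orlicz \<Phi>1 \<alpha>. lux_norm \<Phi>2 \<beta> f \<le> C' * lux_norm \<Phi>1 \<alpha> f)"

end

(* The embedding is governed by the pointwise estimate
   Phi(|f(z)|/32) <= c (Im z)^(-2-gamma) for f in the unit ball of A^Phi_gamma, which is the
   sub-mean-value inequality of |f| combined with Jensen's inequality.

   Sufficiency: for f in the unit ball of A^Phi1_alpha the estimate gives
   Phi1(s) <= t^(2+alpha) for s = |f(z)|/32 and some t comparable to 1/Im z. As Phi2/Phi1 is
   nondecreasing, Phi2(s)/Phi1(s) is at most its value at Phi1^(-1)(t^(2+alpha)), which the
   condition bounds by C t^(beta-alpha). Hence Phi2(s) y^beta is dominated by Phi1(s) y^alpha.

   Necessity: the functions f_v(z) = Phi1^(-1)(v^(-2-alpha)) (v/(z+iv))^m, with m large, are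
   bounded in A^Phi1_alpha, because Phi1(qs) <= q Phi1(s) for 0 <= q <= 1. The pointwise
   estimate for Phi2 at z = iv, together with Phi2(Ks) <= L Phi2(s), gives the condition at
   t = 1/v. *)

theory Submission
  imports Defs "HOL-Complex_Analysis.Complex_Analysis" "HOL-Probability.Sinc_Integral"
begin

subsection \<open>Growth functions\<close>

text \<open>A growth function may vanish on an initial interval, and then it has no inverse at 0.
  Positivity away from 0 excludes this; with convexity it gives strict monotonicity, so that
  \<open>gf_inv\<close> is a genuine inverse on the half-line.\<close>

locale young_function =
  fixes \<Phi> :: "real \<Rightarrow> real"
  assumes growth: "growth_function \<Phi>"
    and convex: "convex_on {0..} \<Phi>"
    and pos: "t > 0 \<Longrightarrow> \<Phi> t > 0"
begin

lemma mono: "0 \<le> s \<Longrightarrow> s \<le> t \<Longrightarrow> \<Phi> s \<le> \<Phi> t"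
  using growth by (auto simp: growth_function_def mono_on_def)

lemma zero [simp]: "\<Phi> 0 = 0"
proof -
  have "0 \<in> \<Phi> ` {0..}"
    using growth by (simp add: growth_function_def)
  then obtain t where "t \<ge> 0" "\<Phi> t = 0" by auto
  with pos[of t] show ?thesis by (cases "t = 0") auto
qed

lemma nonneg: "t \<ge> 0 \<Longrightarrow> \<Phi> t \<ge> 0"
  using mono[of 0 t] by simp

text \<open>Convexity on the segment from 0 to \<open>s\<close>, where \<Phi> vanishes at 0. This is
  the form in which convexity lets factors at most 1 leave \<Phi>: in the Luxemburg norm, in
  absorbing constants, and for the test functions.\<close>

lemma scale_le:
  assumes "0 \<le> t" "t \<le> 1" "0 \<le> s"
  shows "\<Phi> (t * s) \<le> t * \<Phi> s"
  using convex_onD[OF convex assms(1,2), of 0 s] assms(3) by simp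

lemma strict_mono:
  assumes "0 \<le> s" "s < t"
  shows "\<Phi> s < \<Phi> t"
proof -
  have "\<Phi> s \<le> s / t * \<Phi> t"
    using scale_le[of "s / t" t] assms by simp
  also have "\<dots> < 1 * \<Phi> t"
    using assms by (intro mult_strict_right_mono pos) auto
  finally show ?thesis by simp
qed

lemma less_iff: "0 \<le> s \<Longrightarrow> 0 \<le> t \<Longrightarrow> \<Phi> s < \<Phi> t \<longleftrightarrow> s < t"
  using mono[of t s] strict_mono[of s t] by linarith

lemma le_iff: "0 \<le> s \<Longrightarrow> 0 \<le> t \<Longrightarrow> \<Phi> s \<le> \<Phi> t \<longleftrightarrow> s \<le> t"
  by (meson less_iff not_less)

lemma inj: "inj_on \<Phi> {0..}"
  by (rule inj_onI) (metis atLeast_iff less_iff less_irrefl linorder_neqE_linordered_idom)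

lemma gf_inv_nonneg: "t \<ge> 0 \<Longrightarrow> gf_inv \<Phi> t \<ge> 0"
  using the_inv_into_into[OF inj, of t "{0..}"] growth
  by (simp add: gf_inv_def growth_function_def)

lemma gf_inv [simp]: "t \<ge> 0 \<Longrightarrow> \<Phi> (gf_inv \<Phi> t) = t"
  using f_the_inv_into_f[OF inj, of t] growth
  by (simp add: gf_inv_def growth_function_def)

lemma le_gf_inv_iff: "0 \<le> s \<Longrightarrow> 0 \<le> t \<Longrightarrow> s \<le> gf_inv \<Phi> t \<longleftrightarrow> \<Phi> s \<le> t"
  using le_iff[of s "gf_inv \<Phi> t"] by (simp add: gf_inv_nonneg)

lemma gf_inv_pos: "t > 0 \<Longrightarrow> gf_inv \<Phi> t > 0"
  using gf_inv_nonneg[of t] gf_inv[of t] by (cases "gf_inv \<Phi> t = 0") auto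

text \<open>A supporting line at \<open>a\<close>. It is stated without subtraction, and with
  nonnegative slope, so that it carries over to \<open>ennreal\<close> and can be integrated
  there.\<close>

lemma subgradient:
  assumes "a \<ge> 0"
  obtains m where "m \<ge> 0" "\<And>s. s \<ge> 0 \<Longrightarrow> \<Phi> a + m * s \<le> \<Phi> s + m * a"
proof (cases "a = 0")
  case True
  show ?thesis by (rule that[of 0]) (use True nonneg in auto)
next
  case False
  with assms have a: "a > 0" by simp
  \<comment> \<open>The infimum of the chord slopes to the right of \<open>a\<close>, that is, the
    right derivative. Testing the supporting line at 0 shows that it is nonnegative.\<close>
  define m where "m = Inf ((\<lambda>t. (\<Phi> a - \<Phi> t) / (a - t)) ` ({a<..} \<inter> {0..}))"
  have sub: "\<Phi> a + m * s \<le> \<Phi> s + m * a" if "s \<ge> 0" for s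
  proof -
    have "\<Phi> a + m * (s - a) \<le> \<Phi> s"
      unfolding m_def using a that by (intro convex_le_Inf_differential[OF convex]) auto
    then show ?thesis by (simp add: right_diff_distrib)
  qed
  have "m * a \<ge> 0" using sub[of 0] pos[OF a] by simp
  with a have "m \<ge> 0" by (simp add: zero_le_mult_iff)
  then show ?thesis by (rule that) (rule sub)
qed

text \<open>Nothing is known about \<Phi> on negative arguments; composing with the absolute value
  yields a function continuous on the whole line.\<close>

lemma borel_measurable_abs:
  assumes "g \<in> borel_measurable M"
  shows "(\<lambda>x. \<Phi> \<bar>g x\<bar>) \<in> borel_measurable M"
proof -
  have "continuous_on UNIV (\<lambda>x::real. \<Phi> \<bar>x\<bar>)"
    using growth by (intro continuous_on_compose2[of "{0..}" \<Phi> UNIV abs] continuous_on_rabs continuous_on_id)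
      (auto simp: growth_function_def)
  then show ?thesis
    by (intro measurable_compose[OF assms] borel_measurable_continuous_onI)
qed

end

subsection \<open>Orlicz integrals over the half-plane\<close>

lemma open_upper_half [simp]: "open upper_half"
  unfolding upper_half_def using open_halfspace_Im_gt[of 0] by simp

lemma upper_half_borel [measurable]: "upper_half \<in> sets borel"
  by simp

text \<open>Off the half-plane \<open>f\<close> is arbitrary, so the integrand of \<open>orlicz_int\<close> need not be measurable;
  it is replaced by a Borel function that agrees with it almost everywhere.\<close>

lemma (in young_function) orlicz_int_eq:
  assumes "continuous_on upper_half f"
  shows "orlicz_int \<Phi> \<gamma> f =
    (\<integral>\<^sup>+ z. ennreal (\<Phi> (cmod (f z)) * Im z powr \<gamma>) * indicator upper_half z \<partial>lborel)"
proof -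
  define g where "g = (\<lambda>z. indicator upper_half z *\<^sub>R f z)"
  have g [measurable]: "g \<in> borel_measurable borel"
    unfolding g_def by (intro borel_measurable_continuous_on_indicator assms) simp
  have [measurable]: "(\<lambda>z. \<Phi> (cmod (g z))) \<in> borel_measurable borel"
    using borel_measurable_abs[of "\<lambda>z. cmod (g z)" borel] by simp
  have "orlicz_int \<Phi> \<gamma> f = (\<integral>\<^sup>+ z. ennreal (\<Phi> (cmod (g z))) \<partial>V \<gamma>)"
    unfolding orlicz_int_def V_def
    by (intro nn_integral_cong_AE, subst AE_density)
       (auto simp: g_def upper_half_def split: if_splits intro!: AE_I2)
  also have "\<dots> = (\<integral>\<^sup>+ z. (if Im z > 0 then ennreal (Im z powr \<gamma>) else 0) * ennreal (\<Phi> (cmod (g z))) \<partial>lborel)"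
    unfolding V_def by (rule nn_integral_density) measurable
  also have "\<dots> = (\<integral>\<^sup>+ z. ennreal (\<Phi> (cmod (f z)) * Im z powr \<gamma>) * indicator upper_half z \<partial>lborel)"
    by (intro nn_integral_cong)
       (auto simp: g_def upper_half_def indicator_def ennreal_mult' nonneg mult.commute)
  finally show ?thesis .
qed

lemma (in young_function) orlicz_integrand_measurable:
  assumes "continuous_on upper_half f"
  shows "(\<lambda>z. ennreal (\<Phi> (cmod (f z)) * Im z powr \<gamma>) * indicator upper_half z) \<in> borel_measurable borel"
proof -
  define g where "g = (\<lambda>z. indicator upper_half z *\<^sub>R f z)"
  have g [measurable]: "g \<in> borel_measurable borel"
    unfolding g_def by (intro borel_measurable_continuous_on_indicator assms) simp
  have [measurable]: "(\<lambda>z. \<Phi> (cmod (g z))) \<in> borel_measurable borel"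
    using borel_measurable_abs[of "\<lambda>z. cmod (g z)" borel] by simp
  have "(\<lambda>z. ennreal (\<Phi> (cmod (g z)) * Im z powr \<gamma>) * indicator upper_half z) \<in> borel_measurable borel"
    by measurable
  also have "(\<lambda>z. ennreal (\<Phi> (cmod (g z)) * Im z powr \<gamma>) * indicator upper_half z) =
     (\<lambda>z. ennreal (\<Phi> (cmod (f z)) * Im z powr \<gamma>) * indicator upper_half z)"
    by (auto simp: g_def indicator_def)
  finally show ?thesis .
qed

subsection \<open>The pointwise estimate\<close>

text \<open>Cauchy's formula, with the kernel bounded on the circle. The point \<open>z\<close> is
  allowed off the centre so that the centre can later vary while \<open>z\<close> stays
  fixed.\<close>

lemma circle_mean_bound:
  assumes hol: "f holomorphic_on cball w R" and R: "R > 0" and z: "dist z w \<le> R / 2"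
  shows "ennreal (cmod (f z)) \<le> 2 * (\<integral>\<^sup>+ t. ennreal (cmod (f (circlepath w R t))) * indicator {0..1} t \<partial>lborel)"
proof -
  let ?c = "circlepath w R"
  let ?g = "\<lambda>t. f (?c t) / (?c t - z) * vector_derivative ?c (at t)"
  have zR: "cmod (z - w) < R" using z R by (simp add: dist_norm)
  have "((\<lambda>u. f u / (u - z)) has_contour_integral (2 * of_real pi * \<i> * f z)) ?c"
    by (rule Cauchy_integral_circlepath_simple[OF hol zR])
  then have g: "(?g has_integral (2 * of_real pi * \<i> * f z)) {0..1}"
    by (simp add: has_contour_integral)
  have c: "?c t \<in> sphere w R" for t
    using R by (simp add: circlepath dist_norm norm_mult)
  have cont: "continuous_on {0..1} (\<lambda>t. f (?c t))"
    by (rule continuous_on_compose2[OF holomorphic_on_imp_continuous_on[OF hol]])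
       (use c path_circlepath[of w R] in \<open>auto simp: path_def simp del: path_circlepath\<close>)
  have int: "((\<lambda>t. cmod (f (?c t))) has_integral integral {0..1} (\<lambda>t. cmod (f (?c t)))) {0..1}"
    by (intro integrable_integral integrable_continuous_real continuous_on_norm cont)
  \<comment> \<open>The path has speed 2 pi R, and the circle stays at distance at least R / 2 from
    \<open>z\<close>. Dividing by the modulus 2 pi in Cauchy's formula leaves the constant
    2.\<close>
  have "cmod (?g t) \<le> 4 * pi * cmod (f (?c t))" for t
  proof -
    have "R / 2 \<le> cmod (?c t - z)"
      using c[of t] z dist_triangle[of w "?c t" z] by (simp add: dist_commute dist_norm norm_minus_commute)
    then have "cmod (f (?c t)) * (2 * pi * R) / cmod (?c t - z) \<le> cmod (f (?c t)) * (2 * pi * R) / (R / 2)"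
      using R by (intro divide_left_mono mult_nonneg_nonneg mult_pos_pos) auto
    then show ?thesis
      using R by (simp add: vector_derivative_circlepath norm_mult norm_divide mult_ac)
  qed
  then have "cmod (integral {0..1} ?g) \<le> integral {0..1} (\<lambda>t. 4 * pi * cmod (f (?c t)))"
    using g int by (intro integral_norm_bound_integral integrable_on_mult_right) (auto simp: integrable_on_def)
  then have "cmod (f z) \<le> 2 * integral {0..1} (\<lambda>t. cmod (f (?c t)))"
    using integral_unique[OF g] by (simp add: norm_mult)
  also have "ennreal \<dots> = 2 * (\<integral>\<^sup>+ t. ennreal (cmod (f (?c t))) * indicator {0..1} t \<partial>lborel)"
    by (simp add: nn_integral_has_integral_lebesgue'[OF _ int] ennreal_mult' ennreal_numeral)
  finally show ?thesis by (simp add: ennreal_leI)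
qed

lemma emeasure_lborel_ball:
  "emeasure lborel (ball x r) = ennreal (measure lborel (ball x r))"
  using emeasure_lborel_ball_finite[of x r]
  by (intro emeasure_eq_ennreal_measure) (auto simp: less_top)

text \<open>Averaging the circle bound over the centre \<open>w\<close> of the circle instead of its radius needs only
  Tonelli and translation invariance, and no polar coordinates.\<close>

lemma ball_mean_bound:
  assumes hol: "f holomorphic_on ball z (2 * R)" and R: "R > 0"
  shows "ennreal (cmod (f z)) * emeasure lborel (ball z (2 * R)) \<le>
    32 * (\<integral>\<^sup>+ u. ennreal (cmod (f u)) * indicator (ball z (2 * R)) u \<partial>lborel)"
proof -
  let ?B = "ball z (R / 2)"
  define F where "F = (\<lambda>u. ennreal (cmod (f u)) * indicator (ball z (2 * R)) u)"
  have F [measurable]: "F \<in> borel_measurable borel"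
  proof -
    have [measurable]: "(\<lambda>u. indicator (ball z (2 * R)) u *\<^sub>R f u) \<in> borel_measurable borel"
      using holomorphic_on_imp_continuous_on[OF hol] by (intro borel_measurable_continuous_on_indicator) auto
    have "F = (\<lambda>u. ennreal (cmod (indicator (ball z (2 * R)) u *\<^sub>R f u)))"
      by (auto simp: F_def indicator_def)
    also have "\<dots> \<in> borel_measurable borel" by measurable
    finally show ?thesis .
  qed
  \<comment> \<open>Joint measurability in centre and parameter, as required for exchanging the two
    integrals.\<close>
  have [measurable]: "(\<lambda>(w, t). circlepath w R t) \<in> borel_measurable (borel \<Otimes>\<^sub>M borel)"
    unfolding borel_prod case_prod_unfold circlepath by (intro borel_measurable_continuous_onI continuous_intros)
  have "ennreal (cmod (f z)) * emeasure lborel ?B = (\<integral>\<^sup>+ w. ennreal (cmod (f z)) * indicator ?B w \<partial>lborel)"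
    by (simp add: nn_integral_cmult_indicator)
  also have "\<dots> \<le> (\<integral>\<^sup>+ w. \<integral>\<^sup>+ t. 2 * F (circlepath w R t) * indicator {0..1} t \<partial>lborel \<partial>lborel)"
  proof (intro nn_integral_mono)
    fix w
    show "ennreal (cmod (f z)) * indicator ?B w \<le> (\<integral>\<^sup>+ t. 2 * F (circlepath w R t) * indicator {0..1} t \<partial>lborel)"
    proof (cases "w \<in> ?B")
      case True
      \<comment> \<open>A centre within R / 2 of \<open>z\<close> keeps the circle within 3 R / 2 of
        \<open>z\<close>, where the cutoff in \<open>F\<close> has no effect.\<close>
      have sub: "cball w R \<subseteq> ball z (2 * R)"
        using True R by (simp add: cball_subset_ball_iff dist_commute)
      have "circlepath w R t \<in> ball z (2 * R)" for t
        using R by (intro subsetD[OF sub]) (simp add: circlepath dist_norm norm_mult)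
      then have F_eq: "F (circlepath w R t) = ennreal (cmod (f (circlepath w R t)))" for t
        by (simp add: F_def)
      have "ennreal (cmod (f z)) \<le> 2 * (\<integral>\<^sup>+ t. F (circlepath w R t) * indicator {0..1} t \<partial>lborel)"
        unfolding F_eq using True R
        by (intro circle_mean_bound holomorphic_on_subset[OF hol sub]) auto
      also have "\<dots> = (\<integral>\<^sup>+ t. 2 * F (circlepath w R t) * indicator {0..1} t \<partial>lborel)"
        by (subst nn_integral_cmult[symmetric]) (auto simp: mult.assoc)
      finally show ?thesis using True by simp
    qed simp
  qed
  also have "\<dots> = (\<integral>\<^sup>+ t. \<integral>\<^sup>+ w. 2 * F (circlepath w R t) * indicator {0..1} t \<partial>lborel \<partial>lborel)"
    by (rule lborel_pair.Fubini'[symmetric]) measurable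
  also have "\<dots> = (\<integral>\<^sup>+ t. (2 * (\<integral>\<^sup>+ u. F u \<partial>lborel)) * indicator {0..1::real} t \<partial>lborel)"
  proof (intro nn_integral_cong)
    fix t :: real
    \<comment> \<open>For fixed \<open>t\<close> the point on the circle is the centre translated by
      \<open>?a\<close>, so integrating over all centres gives the integral of \<open>F\<close>,
      independently of \<open>t\<close>.\<close>
    let ?a = "R * exp (2 * of_real pi * \<i> * t)"
    have "(\<integral>\<^sup>+ u. F u \<partial>lborel) = (\<integral>\<^sup>+ u. F u \<partial>distr lborel borel ((+) ?a))"
      by (simp only: lborel_distr_plus)
    also have "\<dots> = (\<integral>\<^sup>+ w. F (circlepath w R t) \<partial>lborel)"
      by (subst nn_integral_distr) (auto simp: circlepath add.commute)
    finally show "(\<integral>\<^sup>+ w. 2 * F (circlepath w R t) * indicator {0..1} t \<partial>lborel) =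
        (2 * (\<integral>\<^sup>+ u. F u \<partial>lborel)) * indicator {0..1} t"
      by (simp add: nn_integral_cmult nn_integral_multc)
  qed
  also have "\<dots> = 2 * (\<integral>\<^sup>+ u. F u \<partial>lborel)"
    by (simp add: nn_integral_cmult_indicator)
  finally have *: "ennreal (cmod (f z)) * emeasure lborel ?B \<le> 2 * (\<integral>\<^sup>+ u. F u \<partial>lborel)" .
  \<comment> \<open>The radii 2 R and R / 2 have ratio 4, hence the areas have ratio 16; with the
    factor 2 from the circle bound this makes 32.\<close>
  have "emeasure lborel (ball z (2 * R)) = 16 * emeasure lborel ?B"
  proof -
    have "measure lborel (ball z (2 * R)) = 16 * measure lborel ?B"
      using R content_ball_conv_unit_ball[of "2 * R" z] content_ball_conv_unit_ball[of "R / 2" z]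
      by (simp add: power2_eq_square)
    then show ?thesis
      by (simp add: emeasure_lborel_ball ennreal_mult')
  qed
  then have "ennreal (cmod (f z)) * emeasure lborel (ball z (2 * R)) = 16 * (ennreal (cmod (f z)) * emeasure lborel ?B)"
    by (simp add: mult_ac)
  also have "\<dots> \<le> 16 * (2 * (\<integral>\<^sup>+ u. F u \<partial>lborel))"
    by (intro mult_left_mono *) simp
  finally show ?thesis by (simp add: F_def mult.assoc[symmetric])
qed

text \<open>Jensen's inequality by integrating the supporting line at |f(z)| / 32 over the ball. The
  mean value bound controls the linear term, and its constant 32 therefore ends up inside
  \<Phi>.\<close>

lemma (in young_function) ball_Jensen:
  assumes hol: "f holomorphic_on ball z (2 * R)" and R: "R > 0"
  shows "ennreal (\<Phi> (cmod (f z) / 32)) * emeasure lborel (ball z (2 * R)) \<le>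
    (\<integral>\<^sup>+ u. ennreal (\<Phi> (cmod (f u))) * indicator (ball z (2 * R)) u \<partial>lborel)"
proof -
  let ?B = "ball z (2 * R)" and ?a = "cmod (f z) / 32"
  obtain m where m: "m \<ge> 0" "\<And>s. s \<ge> 0 \<Longrightarrow> \<Phi> ?a + m * s \<le> \<Phi> s + m * ?a"
    using subgradient[of ?a] by auto
  have [measurable]: "?B \<in> sets borel" by (intro borel_open open_ball)
  define g where "g = (\<lambda>u. indicator ?B u *\<^sub>R f u)"
  have g [measurable]: "g \<in> borel_measurable borel"
    unfolding g_def using holomorphic_on_imp_continuous_on[OF hol]
    by (intro borel_measurable_continuous_on_indicator) auto
  have [measurable]: "(\<lambda>u. \<Phi> (cmod (g u))) \<in> borel_measurable borel"
    using borel_measurable_abs[of "\<lambda>u. cmod (g u)" borel] by simp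
  define N where "N = emeasure lborel ?B"
  have N: "N < \<infinity>" unfolding N_def by (simp add: emeasure_lborel_ball)
  define I where "I = (\<integral>\<^sup>+ u. ennreal (cmod (g u)) * indicator ?B u \<partial>lborel)"
  have I_eq: "I = (\<integral>\<^sup>+ u. ennreal (cmod (f u)) * indicator ?B u \<partial>lborel)"
    unfolding I_def g_def by (intro nn_integral_cong) (auto simp: indicator_def)
  have "ennreal (cmod (f z)) = 32 * ennreal ?a"
    by (simp add: ennreal_mult'[symmetric] flip: ennreal_numeral)
  then have "32 * (ennreal ?a * N) \<le> 32 * I"
    using ball_mean_bound[OF hol R] by (simp add: N_def I_eq mult.assoc)
  then have aI: "ennreal ?a * N \<le> I"
    by (subst (asm) ennreal_mult_le_mult_iff) auto
  have "ennreal m * (ennreal ?a * N) + ennreal (\<Phi> ?a) * N \<le> ennreal m * I + ennreal (\<Phi> ?a) * N"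
    by (intro add_right_mono mult_left_mono aI) simp
  also have "\<dots> = (\<integral>\<^sup>+ u. ennreal m * (ennreal (cmod (g u)) * indicator ?B u) + ennreal (\<Phi> ?a) * indicator ?B u \<partial>lborel)"
    unfolding I_def N_def
    by (subst nn_integral_add) (auto simp: nn_integral_cmult nn_integral_cmult_indicator)
  also have "\<dots> \<le> (\<integral>\<^sup>+ u. ennreal (m * ?a) * indicator ?B u + ennreal (\<Phi> (cmod (g u))) * indicator ?B u \<partial>lborel)"
  proof (intro nn_integral_mono)
    fix u
    have "ennreal m * ennreal (cmod (g u)) + ennreal (\<Phi> ?a) \<le> ennreal (m * ?a) + ennreal (\<Phi> (cmod (g u)))"
      using m(1) m(2)[of "cmod (g u)"] nonneg[of ?a] nonneg[of "cmod (g u)"]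
      by (simp add: ennreal_mult'[symmetric] ennreal_plus[symmetric] add.commute del: ennreal_plus)
    then show "ennreal m * (ennreal (cmod (g u)) * indicator ?B u) + ennreal (\<Phi> ?a) * indicator ?B u \<le>
        ennreal (m * ?a) * indicator ?B u + ennreal (\<Phi> (cmod (g u))) * indicator ?B u"
      by (auto simp: indicator_def)
  qed
  also have "\<dots> = ennreal m * (ennreal ?a * N) + (\<integral>\<^sup>+ u. ennreal (\<Phi> (cmod (g u))) * indicator ?B u \<partial>lborel)"
    unfolding ennreal_mult'[OF m(1)]
    by (subst nn_integral_add) (auto simp: N_def nn_integral_cmult nn_integral_cmult_indicator mult.assoc)
  also have "(\<integral>\<^sup>+ u. ennreal (\<Phi> (cmod (g u))) * indicator ?B u \<partial>lborel) =
      (\<integral>\<^sup>+ u. ennreal (\<Phi> (cmod (f u))) * indicator ?B u \<partial>lborel)"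
    unfolding g_def by (intro nn_integral_cong) (auto simp: indicator_def)
  \<comment> \<open>Both sides contain the summand m a N, which may be cancelled because the ball
    has finite measure.\<close>
  finally show ?thesis
    using N by (auto simp: ennreal_add_left_cancel_le N_def ennreal_mult_eq_top_iff)
qed

text \<open>On the ball of radius Im z / 2 about \<open>z\<close> the weight is comparable to (Im
  z)^\<gamma> and the area to (Im z)^2, so \<open>ball_Jensen\<close> compares directly with the
  Orlicz integral. The constant depends on \<gamma> only.\<close>

lemma pointwise_estimate:
  "\<exists>c>0. \<forall>\<Phi> f z. young_function \<Phi> \<longrightarrow> f holomorphic_on upper_half \<longrightarrow> orlicz_int \<Phi> \<gamma> f \<le> 1 \<longrightarrow>
     Im z > 0 \<longrightarrow> \<Phi> (cmod (f z) / 32) \<le> c * Im z powr - (2 + \<gamma>)"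
proof -
  \<comment> \<open>Heights in the ball lie between 1/2 and 3/2 of Im z. Which end gives the smaller
    weight depends on the sign of \<gamma>; the minimum covers both.\<close>
  define \<kappa> :: real where "\<kappa> = min ((1 / 2) powr \<gamma>) ((3 / 2) powr \<gamma>)"
  define b where "b = measure lborel (ball (0 :: complex) 1)"
  have \<kappa>: "\<kappa> > 0" by (simp add: \<kappa>_def)
  have b: "b > 0" by (simp add: b_def content_ball_pos)
  have powr_bound: "\<kappa> * y powr \<gamma> \<le> x powr \<gamma>" if "y > 0" "y / 2 < x" "x < 3 / 2 * y" for x y :: real
  proof (cases "\<gamma> \<ge> 0")
    case True
    have "\<kappa> * y powr \<gamma> \<le> (1 / 2) powr \<gamma> * y powr \<gamma>"
      by (intro mult_right_mono) (auto simp: \<kappa>_def)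
    also have "\<dots> = (y / 2) powr \<gamma>"
      using that by (subst powr_mult[symmetric]) auto
    also have "\<dots> \<le> x powr \<gamma>"
      using True that by (intro powr_mono2) auto
    finally show ?thesis .
  next
    case False
    have "\<kappa> * y powr \<gamma> \<le> (3 / 2) powr \<gamma> * y powr \<gamma>"
      by (intro mult_right_mono) (auto simp: \<kappa>_def)
    also have "\<dots> = (3 / 2 * y) powr \<gamma>"
      using that by (subst powr_mult) auto
    also have "\<dots> \<le> x powr \<gamma>"
      using False that by (intro powr_mono2') auto
    finally show ?thesis .
  qed
  show ?thesis
  \<comment> \<open>The constant comes from solving \<kappa> y^\<gamma> \<Phi>(a) (y^2 / 4) b \<le>
    1 for \<Phi>(a), where y = Im z, a = |f(z)| / 32, and \<open>b\<close> is the area of the unit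
    disc.\<close>
  proof (intro exI[of _ "4 / (\<kappa> * b)"] conjI allI impI)
    show "4 / (\<kappa> * b) > 0" using \<kappa> b by simp
    fix \<Phi> f z
    assume "young_function \<Phi>" and hol: "f holomorphic_on upper_half"
      and le1: "orlicz_int \<Phi> \<gamma> f \<le> 1" and z: "Im z > 0"
    interpret young_function \<Phi> by fact
    define y where "y = Im z"
    let ?B = "ball z (2 * (y / 4))" and ?a = "cmod (f z) / 32"
    have y: "y > 0" using z by (simp add: y_def)
    have Im_B: "y / 2 < Im u" "Im u < 3 / 2 * y" if "u \<in> ?B" for u
      using that abs_Im_le_cmod[of "z - u"] by (auto simp: y_def dist_norm)
    have sub: "?B \<subseteq> upper_half"
      using Im_B(1) y by (force simp: upper_half_def)
    have content: "emeasure lborel ?B = ennreal (y\<^sup>2 / 4 * b)"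
      using y content_ball_conv_unit_ball[of "2 * (y / 4)" z]
      by (simp add: emeasure_lborel_ball b_def power2_eq_square)
    have "ennreal (\<kappa> * y powr \<gamma> * (\<Phi> ?a * (y\<^sup>2 / 4 * b))) =
        ennreal (\<kappa> * y powr \<gamma>) * (ennreal (\<Phi> ?a) * emeasure lborel ?B)"
    proof -
      have "\<kappa> * y powr \<gamma> \<ge> 0" "\<Phi> ?a \<ge> 0" using \<kappa> nonneg[of ?a] by auto
      then show ?thesis
        by (simp only: content ennreal_mult'[of "\<kappa> * y powr \<gamma>"] ennreal_mult'[of "\<Phi> ?a"])
    qed
    also have "\<dots> \<le> ennreal (\<kappa> * y powr \<gamma>) * (\<integral>\<^sup>+ u. ennreal (\<Phi> (cmod (f u))) * indicator ?B u \<partial>lborel)"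
      using y by (intro mult_left_mono ball_Jensen holomorphic_on_subset[OF hol sub]) auto
    also have "\<dots> = (\<integral>\<^sup>+ u. ennreal (\<kappa> * y powr \<gamma>) * (ennreal (\<Phi> (cmod (f u))) * indicator ?B u) \<partial>lborel)"
    proof (rule nn_integral_cmult[symmetric])
      have [measurable]: "?B \<in> sets borel" by (intro borel_open open_ball)
      define g where "g = (\<lambda>u. indicator ?B u *\<^sub>R f u)"
      have [measurable]: "g \<in> borel_measurable borel"
        unfolding g_def using holomorphic_on_imp_continuous_on[OF holomorphic_on_subset[OF hol sub]]
        by (intro borel_measurable_continuous_on_indicator) auto
      have [measurable]: "(\<lambda>u. \<Phi> (cmod (g u))) \<in> borel_measurable borel"
        using borel_measurable_abs[of "\<lambda>u. cmod (g u)" borel] by simp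
      have "(\<lambda>u. ennreal (\<Phi> (cmod (f u))) * indicator ?B u) = (\<lambda>u. ennreal (\<Phi> (cmod (g u))) * indicator ?B u)"
        by (auto simp: g_def indicator_def)
      also have "\<dots> \<in> borel_measurable lborel" by measurable
      finally show "(\<lambda>u. ennreal (\<Phi> (cmod (f u))) * indicator ?B u) \<in> borel_measurable lborel" .
    qed
    also have "\<dots> \<le> (\<integral>\<^sup>+ u. ennreal (\<Phi> (cmod (f u)) * Im u powr \<gamma>) * indicator upper_half u \<partial>lborel)"
    proof (intro nn_integral_mono)
      fix u
      show "ennreal (\<kappa> * y powr \<gamma>) * (ennreal (\<Phi> (cmod (f u))) * indicator ?B u) \<le>
          ennreal (\<Phi> (cmod (f u)) * Im u powr \<gamma>) * indicator upper_half u"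
      proof (cases "u \<in> ?B")
        case True
        then have "\<Phi> (cmod (f u)) * (\<kappa> * y powr \<gamma>) \<le> \<Phi> (cmod (f u)) * Im u powr \<gamma>"
          using powr_bound[OF y Im_B] by (intro mult_left_mono nonneg) auto
        then have "ennreal (\<kappa> * y powr \<gamma>) * ennreal (\<Phi> (cmod (f u))) \<le> ennreal (\<Phi> (cmod (f u)) * Im u powr \<gamma>)"
          using \<kappa> nonneg[of "cmod (f u)"]
          by (subst ennreal_mult'[symmetric]) (auto simp: mult.commute intro!: ennreal_leI)
        then show ?thesis using True sub by auto
      qed simp
    qed
    also have "\<dots> = orlicz_int \<Phi> \<gamma> f"
      by (rule orlicz_int_eq[symmetric]) (rule holomorphic_on_imp_continuous_on[OF hol])
    also have "\<dots> \<le> ennreal 1" using le1 by simp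
    finally have "\<kappa> * y powr \<gamma> * (\<Phi> ?a * (y\<^sup>2 / 4 * b)) \<le> 1"
      by (subst (asm) ennreal_le_iff) auto
    then have "\<Phi> ?a * (y\<^sup>2 * y powr \<gamma>) \<le> 4 / (\<kappa> * b)"
      using \<kappa> b by (simp add: field_simps)
    then have "\<Phi> ?a \<le> 4 / (\<kappa> * b) / (y\<^sup>2 * y powr \<gamma>)"
      using y by (subst pos_le_divide_eq) auto
    also have "\<dots> = 4 / (\<kappa> * b) * y powr - (2 + \<gamma>)"
      using y by (simp add: powr_minus_divide powr_add powr_numeral del: minus_add_distrib)
    finally show "\<Phi> (cmod (f z) / 32) \<le> 4 / (\<kappa> * b) * Im z powr - (2 + \<gamma>)"
      by (simp add: y_def)
  qed
qed

subsection \<open>The Luxemburg norm\<close>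

lemma holomorphic_upper_half_divide:
  "f holomorphic_on upper_half \<Longrightarrow> (\<lambda>z. f z / complex_of_real r) holomorphic_on upper_half"
  unfolding divide_inverse by (intro holomorphic_intros)

context young_function
begin

lemma orlicz_int_divide_le:
  assumes "f holomorphic_on upper_half" and "r \<ge> 1"
  shows "orlicz_int \<Phi> \<gamma> (\<lambda>z. f z / complex_of_real r) \<le> ennreal (1 / r) * orlicz_int \<Phi> \<gamma> f"
proof -
  have cont: "continuous_on upper_half f" "continuous_on upper_half (\<lambda>z. f z / complex_of_real r)"
    using assms holomorphic_upper_half_divide by (auto intro: holomorphic_on_imp_continuous_on)
  have "\<Phi> (cmod (f z) / r) * Im z powr \<gamma> \<le> 1 / r * (\<Phi> (cmod (f z)) * Im z powr \<gamma>)" for z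
    using mult_right_mono[OF scale_le[of "1 / r" "cmod (f z)"], of "Im z powr \<gamma>"] \<open>r \<ge> 1\<close> by simp
  then have "ennreal (\<Phi> (cmod (f z) / r) * Im z powr \<gamma>) \<le> ennreal (1 / r) * ennreal (\<Phi> (cmod (f z)) * Im z powr \<gamma>)" for z
    using \<open>r \<ge> 1\<close> by (subst ennreal_mult'[symmetric]) (auto intro: ennreal_leI)
  then show ?thesis
    unfolding orlicz_int_eq[OF cont(1)] orlicz_int_eq[OF cont(2)] using \<open>r \<ge> 1\<close>
    by (subst nn_integral_cmult[symmetric])
       (auto simp: norm_divide split: split_indicator
             intro!: orlicz_integrand_measurable[OF cont(1)] nn_integral_mono)
qed

lemma orlicz_int_mono:
  assumes "\<And>z. cmod (f z) \<le> cmod (g z)"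
  shows "orlicz_int \<Phi> \<gamma> f \<le> orlicz_int \<Phi> \<gamma> g"
  unfolding orlicz_int_def by (intro nn_integral_mono ennreal_leI mono assms) auto

lemma lux_norm_le:
  assumes "r > 0" "orlicz_int \<Phi> \<gamma> (\<lambda>z. f z / complex_of_real r) \<le> 1"
  shows "lux_norm \<Phi> \<gamma> f \<le> r"
  unfolding lux_norm_def using assms
  by (intro cInf_lower bdd_belowI[of _ 0]) auto

text \<open>Ensures that the set defining \<open>lux_norm\<close> is nonempty, without which the
  real \<open>Inf\<close> carries no information. A finite integral is brought below 1 by dividing
  by its own value.\<close>

lemma orlicz_int_divide_le_1:
  assumes f: "f \<in> bergman_orlicz \<Phi> \<gamma>"
  obtains r where "r \<ge> 1" "orlicz_int \<Phi> \<gamma> (\<lambda>z. f z / complex_of_real r) \<le> 1"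
proof -
  have hol: "f holomorphic_on upper_half" and fin: "orlicz_int \<Phi> \<gamma> f < \<infinity>"
    using f by (auto simp: bergman_orlicz_def)
  obtain M where M: "M \<ge> 0" "orlicz_int \<Phi> \<gamma> f = ennreal M"
    using fin by (cases "orlicz_int \<Phi> \<gamma> f") auto
  define r where "r = max 1 M"
  have "orlicz_int \<Phi> \<gamma> (\<lambda>z. f z / complex_of_real r) \<le> ennreal (1 / r) * ennreal M"
    using orlicz_int_divide_le[OF hol, of r \<gamma>] M by (simp add: r_def)
  also have "\<dots> = ennreal (M / r)"
    using M by (simp add: r_def ennreal_mult'[symmetric])
  also have "\<dots> \<le> ennreal 1"
    by (intro ennreal_leI) (simp add: r_def divide_le_eq)
  finally show ?thesis by (intro that[of r]) (auto simp: r_def)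
qed

lemma lux_norm_nonneg:
  assumes "f \<in> bergman_orlicz \<Phi> \<gamma>"
  shows "lux_norm \<Phi> \<gamma> f \<ge> 0"
  unfolding lux_norm_def
  by (rule orlicz_int_divide_le_1[OF assms], rule cInf_greatest) force+

text \<open>The admissible radii are closed upwards, so everything strictly above the infimum is
  admissible. With the strict inequality it is not necessary to know that the infimum is
  attained.\<close>

lemma lux_norm_less_imp:
  assumes f: "f \<in> bergman_orlicz \<Phi> \<gamma>" and r: "lux_norm \<Phi> \<gamma> f < r"
  shows "orlicz_int \<Phi> \<gamma> (\<lambda>z. f z / complex_of_real r) \<le> 1"
proof -
  let ?S = "{r. r > 0 \<and> orlicz_int \<Phi> \<gamma> (\<lambda>z. f z / complex_of_real r) \<le> 1}"
  have "?S \<noteq> {}"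
    by (rule orlicz_int_divide_le_1[OF f]) force
  from cInf_lessD[OF this r[unfolded lux_norm_def]] obtain s
    where s: "s > 0" "orlicz_int \<Phi> \<gamma> (\<lambda>z. f z / complex_of_real s) \<le> 1" "s < r" by auto
  have "orlicz_int \<Phi> \<gamma> (\<lambda>z. f z / complex_of_real r) \<le> orlicz_int \<Phi> \<gamma> (\<lambda>z. f z / complex_of_real s)"
    using s by (intro orlicz_int_mono) (auto simp: norm_divide intro!: divide_left_mono)
  with s(2) show ?thesis by simp
qed

end

subsection \<open>Comparison of the two spaces\<close>

lemma ratio_estimate:
  assumes "young_function \<Phi>1" "young_function \<Phi>2"
    and ratio: "mono_on {0<..} (\<lambda>t. \<Phi>2 t / \<Phi>1 t)"
    and t: "t > 0"
    and inv: "gf_inv \<Phi>1 (t powr (2 + \<alpha>)) \<le> gf_inv \<Phi>2 (C * t powr (2 + \<beta>))"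
    and s: "s \<ge> 0" "\<Phi>1 s \<le> t powr (2 + \<alpha>)" and C: "C > 0"
  shows "\<Phi>2 s \<le> C * t powr (\<beta> - \<alpha>) * \<Phi>1 s"
\<comment> \<open>The ratio is monotone on positive arguments only; at 0 both sides vanish.\<close>
proof (cases "s = 0")
  case True
  then show ?thesis
    using assms(1,2) by (simp add: young_function.zero)
next
  case False
  interpret A: young_function \<Phi>1 by fact
  interpret B: young_function \<Phi>2 by fact
  define s0 where "s0 = gf_inv \<Phi>1 (t powr (2 + \<alpha>))"
  have "s \<le> s0"
    unfolding s0_def using s t by (subst A.le_gf_inv_iff) auto
  have "s0 > 0" unfolding s0_def using t by (intro A.gf_inv_pos) simp
  have "\<Phi>2 s / \<Phi>1 s \<le> \<Phi>2 s0 / \<Phi>1 s0"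
    using False s(1) \<open>s \<le> s0\<close> by (intro mono_onD[OF ratio]) auto
  also have "\<Phi>1 s0 = t powr (2 + \<alpha>)" by (simp add: s0_def)
  also have "\<Phi>2 s0 \<le> C * t powr (2 + \<beta>)"
    using inv \<open>s0 > 0\<close> C by (subst B.le_gf_inv_iff[symmetric]) (auto simp: s0_def)
  also have "C * t powr (2 + \<beta>) / t powr (2 + \<alpha>) = C * t powr (\<beta> - \<alpha>)"
    using t by (simp add: powr_add powr_diff)
  finally have "\<Phi>2 s / \<Phi>1 s \<le> C * t powr (\<beta> - \<alpha>)"
    by (simp add: divide_right_mono)
  then show ?thesis
    using A.pos[of s] False s(1) by (simp add: divide_le_eq)
qed

text \<open>The embedding at the level of unit balls: one \<open>K\<close> serves all
  \<open>f\<close>, and the norm inequality later follows by scaling.\<close>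

lemma orlicz_int_transfer:
  assumes y1: "young_function \<Phi>1" and y2: "young_function \<Phi>2"
    and ratio: "mono_on {0<..} (\<lambda>t. \<Phi>2 t / \<Phi>1 t)"
    and \<alpha>: "\<alpha> > -2" and C: "C > 0"
    and inv: "\<And>t. t > 0 \<Longrightarrow> gf_inv \<Phi>1 (t powr (2 + \<alpha>)) \<le> gf_inv \<Phi>2 (C * t powr (2 + \<beta>))"
  obtains K :: real where "K > 0"
    "\<And>f. f holomorphic_on upper_half \<Longrightarrow> orlicz_int \<Phi>1 \<alpha> f \<le> 1 \<Longrightarrow>
       orlicz_int \<Phi>2 \<beta> (\<lambda>z. f z / complex_of_real K) \<le> 1"
proof -
  interpret A: young_function \<Phi>1 by fact
  interpret B: young_function \<Phi>2 by fact
  obtain c where c: "c > 0"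
    "\<And>\<Phi> f z. young_function \<Phi> \<Longrightarrow> f holomorphic_on upper_half \<Longrightarrow> orlicz_int \<Phi> \<alpha> f \<le> 1 \<Longrightarrow>
       Im z > 0 \<Longrightarrow> \<Phi> (cmod (f z) / 32) \<le> c * Im z powr - (2 + \<alpha>)"
    using pointwise_estimate[of \<alpha>] by blast
  \<comment> \<open>Chosen so that d^(2+\<alpha>) = c; the pointwise bound c y^-(2+\<alpha>) then
    reads t^(2+\<alpha>) with t = d / y.\<close>
  define d where "d = c powr (1 / (2 + \<alpha>))"
  have d: "d > 0" using c by (simp add: d_def)
  \<comment> \<open>Absorbs the factor left by \<open>ratio_estimate\<close>; the maximum with 1
    makes 1 / M admissible in \<open>scale_le\<close>. The 32 in the final constant is that of the
    pointwise estimate.\<close>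
  define M where "M = max 1 (C * d powr (\<beta> - \<alpha>))"
  have M: "M \<ge> 1" by (simp add: M_def)
  show ?thesis
  proof (rule that[of "32 * M"])
    show "32 * M > 0" using M by simp
    fix f assume hol: "f holomorphic_on upper_half" and le1: "orlicz_int \<Phi>1 \<alpha> f \<le> 1"
    let ?g = "\<lambda>z. f z / complex_of_real (32 * M)"
    have cont: "continuous_on upper_half f" "continuous_on upper_half ?g"
      by (intro holomorphic_on_imp_continuous_on hol holomorphic_upper_half_divide)+
    have main: "\<Phi>2 (cmod (?g z)) * Im z powr \<beta> \<le> \<Phi>1 (cmod (f z)) * Im z powr \<alpha>" if z: "Im z > 0" for z
    proof -
      define y where "y = Im z"
      define s where "s = cmod (f z) / 32"
      have y: "y > 0" using z by (simp add: y_def)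
      have "\<Phi>1 s \<le> c * y powr - (2 + \<alpha>)"
        unfolding s_def y_def by (rule c(2)[OF y1 hol le1 z])
      also have "\<dots> = (d / y) powr (2 + \<alpha>)"
        using \<alpha> c(1) y d by (simp add: powr_divide powr_minus_divide d_def powr_powr del: minus_add_distrib)
      finally have "\<Phi>2 s \<le> C * (d / y) powr (\<beta> - \<alpha>) * \<Phi>1 s"
        using d y by (intro ratio_estimate[OF y1 y2 ratio _ inv _ _ C]) (auto simp: s_def)
      then have "\<Phi>2 s * y powr \<beta> \<le> C * (d / y) powr (\<beta> - \<alpha>) * \<Phi>1 s * y powr \<beta>"
        by (rule mult_right_mono) simp
      \<comment> \<open>The exchange of weights: y^-(\<beta>-\<alpha>) y^\<beta> =
        y^\<alpha>.\<close>
      also have "\<dots> = C * d powr (\<beta> - \<alpha>) * (\<Phi>1 s * y powr \<alpha>)"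
        using d y by (simp add: powr_divide powr_diff field_simps)
      also have "\<dots> \<le> M * (\<Phi>1 s * y powr \<alpha>)"
        using A.nonneg[of s] by (intro mult_right_mono) (auto simp: M_def s_def)
      finally have *: "\<Phi>2 s * y powr \<beta> / M \<le> \<Phi>1 s * y powr \<alpha>"
        using M by (simp add: divide_le_eq mult.commute)
      have "\<Phi>2 (cmod (?g z)) \<le> \<Phi>2 s / M"
        using B.scale_le[of "1 / M" s] M by (simp add: s_def norm_divide norm_mult mult.commute)
      then have "\<Phi>2 (cmod (?g z)) * y powr \<beta> \<le> \<Phi>2 s / M * y powr \<beta>"
        by (rule mult_right_mono) simp
      also have "\<dots> \<le> \<Phi>1 s * y powr \<alpha>" using * by simp
      also have "\<dots> \<le> \<Phi>1 (cmod (f z)) * y powr \<alpha>"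
        by (intro mult_right_mono A.mono) (auto simp: s_def)
      finally show ?thesis by (simp add: y_def)
    qed
    have "orlicz_int \<Phi>2 \<beta> ?g \<le> orlicz_int \<Phi>1 \<alpha> f"
      unfolding B.orlicz_int_eq[OF cont(2)] A.orlicz_int_eq[OF cont(1)]
      using main by (intro nn_integral_mono) (auto simp: indicator_def upper_half_def intro!: ennreal_leI)
    with le1 show "orlicz_int \<Phi>2 \<beta> ?g \<le> 1" by simp
  qed
qed

subsection \<open>The integral of the test functions\<close>

lemma nn_integral_inverse_1_plus_square: "(\<integral>\<^sup>+ x. ennreal (1 / (1 + x\<^sup>2)) \<partial>lborel) < \<infinity>"
proof -
  have "integrable lborel (\<lambda>x::real. inverse (1 + x\<^sup>2))"
    using integrable_inverse_1_plus_square by (simp add: set_integrable_def einterval_def)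
  then show ?thesis
    by (simp add: integrable_iff_bounded inverse_eq_divide)
qed

text \<open>Split at 1: below, y^\<alpha> is integrable since \<alpha> > -1; above, the integrand is
  at most y^(\<alpha>-n), with exponent less than -1.\<close>

lemma nn_integral_powr_weight:
  assumes \<alpha>: "\<alpha> > -1" and n: "\<alpha> + 1 < real n"
  shows "(\<integral>\<^sup>+ y. ennreal ((1 / (1 + y)) ^ n * y powr \<alpha>) * indicator {0<..} y \<partial>lborel) < \<infinity>"
proof -
  have I1: "(\<integral>\<^sup>+ y. ennreal (y powr \<alpha>) * indicator {0..1} y \<partial>lborel) = ennreal (1 powr (\<alpha> + 1) / (\<alpha> + 1))"
    by (intro nn_integral_has_integral_lebesgue' has_integral_powr_from_0) (use \<alpha> in auto)
  have I2: "(\<integral>\<^sup>+ y. ennreal (y powr (\<alpha> - n)) * indicator {1..} y \<partial>lborel) = ennreal (- (1 powr (\<alpha> - n + 1)) / (\<alpha> - n + 1))"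
    by (intro nn_integral_has_integral_lebesgue' has_integral_powr_to_inf) (use n in auto)
  have "(\<integral>\<^sup>+ y. ennreal ((1 / (1 + y)) ^ n * y powr \<alpha>) * indicator {0<..} y \<partial>lborel) \<le>
      (\<integral>\<^sup>+ y. ennreal (y powr \<alpha>) * indicator {0..1} y + ennreal (y powr (\<alpha> - n)) * indicator {1..} y \<partial>lborel)"
  proof (intro nn_integral_mono)
    fix y :: real
    consider "y \<le> 0" | "0 < y" "y \<le> 1" | "y > 1" by linarith
    then show "ennreal ((1 / (1 + y)) ^ n * y powr \<alpha>) * indicator {0<..} y \<le>
        ennreal (y powr \<alpha>) * indicator {0..1} y + ennreal (y powr (\<alpha> - n)) * indicator {1..} y"
    proof cases
      case 2
      then have "(1 / (1 + y)) ^ n * y powr \<alpha> \<le> 1 * y powr \<alpha>"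
        by (intro mult_right_mono power_le_one) auto
      with 2 have "ennreal ((1 / (1 + y)) ^ n * y powr \<alpha>) * indicator {0<..} y \<le> ennreal (y powr \<alpha>) * indicator {0..1} y"
        by (simp add: ennreal_leI)
      then show ?thesis by (rule add_increasing2[rotated]) simp
    next
      case 3
      then have "(1 / (1 + y)) ^ n * y powr \<alpha> \<le> (1 / y) ^ n * y powr \<alpha>"
        by (intro mult_right_mono power_mono) (auto intro!: divide_left_mono)
      also have "\<dots> = y powr (\<alpha> - n)"
        using 3 by (simp add: powr_diff powr_realpow power_one_over)
      finally show ?thesis using 3 by (auto simp: indicator_def intro!: ennreal_leI)
    qed auto
  qed
  also have "\<dots> = (\<integral>\<^sup>+ y. ennreal (y powr \<alpha>) * indicator {0..1} y \<partial>lborel) + (\<integral>\<^sup>+ y. ennreal (y powr (\<alpha> - n)) * indicator {1..} y \<partial>lborel)"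
    by (rule nn_integral_add) auto
  also have "\<dots> < \<infinity>" by (simp add: I1 I2)
  finally show ?thesis .
qed

lemma nn_integral_complex_prod:
  fixes f g :: "real \<Rightarrow> ennreal"
  assumes "f \<in> borel_measurable borel" "g \<in> borel_measurable borel"
  shows "(\<integral>\<^sup>+ z. f (Re z) * g (Im z) \<partial>lborel) = (\<integral>\<^sup>+ x. f x \<partial>lborel) * (\<integral>\<^sup>+ y. g y \<partial>lborel)"
  \<comment> \<open>The family over the basis 1, \<i> of the plane assigns \<open>f\<close> to the
    real and \<open>g\<close> to the imaginary coordinate.\<close>
  using nn_integral_lborel_prod[of "\<lambda>b :: complex. if b = 1 then f else g"] assms
  by (simp add: Basis_complex_def)

text \<open>The kernel is dominated by a product of a function of Re z and a function of Im z.
  Rescaling by \<open>v\<close> extracts v from the first integral and v^(1+\<alpha>) from the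
  second.\<close>

lemma kernel_integral_bound:
  assumes \<alpha>: "\<alpha> > -1"
  shows "\<exists>m. \<exists>B>0. \<forall>v>0.
    (\<integral>\<^sup>+ z. ennreal ((v / cmod (z + \<i> * complex_of_real v)) ^ m * Im z powr \<alpha>) * indicator upper_half z \<partial>lborel)
      \<le> ennreal (B * v powr (2 + \<alpha>))"
proof -
  obtain n :: nat where n: "\<alpha> + 1 < real n" using reals_Archimedean2 by blast
  define I where "I = (\<integral>\<^sup>+ x. ennreal (1 / (1 + x\<^sup>2)) \<partial>lborel)"
  define J where "J = (\<integral>\<^sup>+ y. ennreal ((1 / (1 + y)) ^ n * y powr \<alpha>) * indicator {0<..} y \<partial>lborel)"
  have "I * J < \<infinity>"
    using nn_integral_inverse_1_plus_square nn_integral_powr_weight[OF \<alpha> n]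
    by (simp add: I_def J_def ennreal_mult_less_top)
  then obtain B0 where B0: "B0 \<ge> 0" "I * J = ennreal B0"
    by (cases "I * J") auto
  show ?thesis
  \<comment> \<open>Of the n + 2 powers, two provide decay in Re z and n provide decay in Im z.
    Adding 1 to \<open>B0\<close> makes the bound positive.\<close>
  proof (intro exI[of _ "n + 2"] exI[of _ "B0 + 1"] conjI allI impI)
    show "B0 + 1 > 0" using B0 by simp
    fix v :: real assume v: "v > 0"
    define f where "f = (\<lambda>x. ennreal (v\<^sup>2 / (v\<^sup>2 + x\<^sup>2)))"
    define g where "g = (\<lambda>y. ennreal ((v / (v + y)) ^ n * y powr \<alpha>) * indicator {0<..} y)"
    have [measurable]: "f \<in> borel_measurable borel" "g \<in> borel_measurable borel"
      by (simp_all add: f_def g_def)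
    have f: "(\<integral>\<^sup>+ x. f x \<partial>lborel) = ennreal v * I"
    proof -
      have "(\<integral>\<^sup>+ x. f x \<partial>lborel) = ennreal \<bar>v\<bar> * (\<integral>\<^sup>+ x. f (0 + v * x) \<partial>lborel)"
        using v by (intro nn_integral_real_affine) auto
      also have "(\<lambda>x. f (0 + v * x)) = (\<lambda>x. ennreal (1 / (1 + x\<^sup>2)))"
      proof
        fix x
        have "v\<^sup>2 / (v\<^sup>2 + (v * x)\<^sup>2) = v\<^sup>2 * 1 / (v\<^sup>2 * (1 + x\<^sup>2))"
          by (simp add: power_mult_distrib distrib_left)
        also have "\<dots> = 1 / (1 + x\<^sup>2)" using v by (subst mult_divide_mult_cancel_left) auto
        finally show "f (0 + v * x) = ennreal (1 / (1 + x\<^sup>2))" by (simp add: f_def)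
      qed
      finally show ?thesis using v by (simp add: I_def)
    qed
    have g: "(\<integral>\<^sup>+ y. g y \<partial>lborel) = ennreal (v powr (1 + \<alpha>)) * J"
    proof -
      have "(\<integral>\<^sup>+ y. g y \<partial>lborel) = ennreal \<bar>v\<bar> * (\<integral>\<^sup>+ y. g (0 + v * y) \<partial>lborel)"
        using v by (intro nn_integral_real_affine) auto
      also have "(\<lambda>y. g (0 + v * y)) =
          (\<lambda>y. ennreal (v powr \<alpha>) * (ennreal ((1 / (1 + y)) ^ n * y powr \<alpha>) * indicator {0<..} y))"
      proof
        fix y
        have "v / (v + v * y) = v * 1 / (v * (1 + y))" by (simp add: distrib_left)
        also have "\<dots> = 1 / (1 + y)" using v by (subst mult_divide_mult_cancel_left) auto
        finally have "(v / (v + v * y)) ^ n * (v * y) powr \<alpha> = v powr \<alpha> * ((1 / (1 + y)) ^ n * y powr \<alpha>)" if "y > 0"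
          using that v by (simp add: powr_mult)
        then show "g (0 + v * y) =
            ennreal (v powr \<alpha>) * (ennreal ((1 / (1 + y)) ^ n * y powr \<alpha>) * indicator {0<..} y)"
          using v by (auto simp: g_def indicator_def zero_less_mult_iff ennreal_mult')
      qed
      also have "(\<integral>\<^sup>+ y. ennreal (v powr \<alpha>) * (ennreal ((1 / (1 + y)) ^ n * y powr \<alpha>) * indicator {0<..} y) \<partial>lborel)
          = ennreal (v powr \<alpha>) * J"
        unfolding J_def by (rule nn_integral_cmult) measurable
      finally show ?thesis
        using v by (simp add: powr_add ennreal_mult' mult.assoc)
    qed
    have "(\<integral>\<^sup>+ z. ennreal ((v / cmod (z + \<i> * complex_of_real v)) ^ (n + 2) * Im z powr \<alpha>) * indicator upper_half z \<partial>lborel)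
        \<le> (\<integral>\<^sup>+ z. f (Re z) * g (Im z) \<partial>lborel)"
    proof (intro nn_integral_mono)
      fix z
      let ?d = "cmod (z + \<i> * complex_of_real v)"
      show "ennreal ((v / ?d) ^ (n + 2) * Im z powr \<alpha>) * indicator upper_half z \<le> f (Re z) * g (Im z)"
      proof (cases "Im z > 0")
        case True
        \<comment> \<open>This lower bound for \<open>?d\<close> serves the n powers that decay in
          Im z; \<open>d2\<close> below serves the remaining two.\<close>
        have d: "v + Im z \<le> ?d"
          using abs_Im_le_cmod[of "z + \<i> * complex_of_real v"] by simp
        have "?d\<^sup>2 = (Re z)\<^sup>2 + (Im z + v)\<^sup>2" by (simp add: cmod_power2)
        moreover have "v\<^sup>2 \<le> (Im z + v)\<^sup>2" using True v by (intro power_mono) auto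
        ultimately have d2: "v\<^sup>2 + (Re z)\<^sup>2 \<le> ?d\<^sup>2" by simp
        have "v / ?d \<le> v / (v + Im z)"
          using True v d by (intro divide_left_mono mult_pos_pos) linarith+
        then have "(v / ?d) ^ n \<le> (v / (v + Im z)) ^ n"
          using v by (intro power_mono) auto
        moreover have "(v / ?d)\<^sup>2 \<le> v\<^sup>2 / (v\<^sup>2 + (Re z)\<^sup>2)"
          unfolding power_divide using v d d2 True
          by (intro divide_left_mono) (auto intro!: mult_pos_pos add_pos_nonneg)
        ultimately have "(v / ?d) ^ n * (v / ?d)\<^sup>2 \<le> (v / (v + Im z)) ^ n * (v\<^sup>2 / (v\<^sup>2 + (Re z)\<^sup>2))"
          using v True by (intro mult_mono) auto
        then have "(v / ?d) ^ (n + 2) * Im z powr \<alpha> \<le>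
            (v / (v + Im z)) ^ n * (v\<^sup>2 / (v\<^sup>2 + (Re z)\<^sup>2)) * Im z powr \<alpha>"
          by (intro mult_right_mono) (auto simp only: power_add powr_ge_zero)
        also have "\<dots> = v\<^sup>2 / (v\<^sup>2 + (Re z)\<^sup>2) * ((v / (v + Im z)) ^ n * Im z powr \<alpha>)"
          by (simp only: mult_ac)
        finally have "ennreal ((v / ?d) ^ (n + 2) * Im z powr \<alpha>) \<le> ennreal (v\<^sup>2 / (v\<^sup>2 + (Re z)\<^sup>2) * ((v / (v + Im z)) ^ n * Im z powr \<alpha>))"
          by (rule ennreal_leI)
        also have "\<dots> = f (Re z) * g (Im z)"
          unfolding f_def g_def using True by (subst ennreal_mult') auto
        finally show ?thesis
          using True by (simp add: upper_half_def)
      qed (simp add: upper_half_def)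
    qed
    also have "\<dots> = (ennreal v * I) * (ennreal (v powr (1 + \<alpha>)) * J)"
      by (simp add: nn_integral_complex_prod f g)
    also have "\<dots> = ennreal v * ennreal (v powr (1 + \<alpha>)) * (I * J)"
      by (simp only: mult_ac)
    also have "\<dots> = ennreal (B0 * v powr (2 + \<alpha>))"
      using v B0 powr_add[of v 1 "1 + \<alpha>"] by (simp add: ennreal_mult'[symmetric] mult.commute)
    also have "\<dots> \<le> ennreal ((B0 + 1) * v powr (2 + \<alpha>))"
      by (intro ennreal_leI mult_right_mono) auto
    finally show "(\<integral>\<^sup>+ z. ennreal ((v / cmod (z + \<i> * complex_of_real v)) ^ (n + 2) * Im z powr \<alpha>) * indicator upper_half z \<partial>lborel)
        \<le> ennreal ((B0 + 1) * v powr (2 + \<alpha>))" .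
  qed
qed

subsection \<open>The embedding theorem\<close>

text \<open>The growth bound of type \<open>q\<close> at the fixed dilation \<open>K\<close>. The
  maximum with 1 secures a positive constant, as the sign of \<open>C\<close> is not prescribed in
  \<open>U_class\<close>.\<close>

lemma (in young_function) doubling_imp:
  assumes "U_union \<Phi>" and "K \<ge> 1"
  obtains L :: real where "L > 0" "\<And>s. s \<ge> 0 \<Longrightarrow> \<Phi> (K * s) \<le> L * \<Phi> s"
proof -
  obtain q C where C: "\<And>s t. s > 0 \<Longrightarrow> t \<ge> 1 \<Longrightarrow> \<Phi> (s * t) \<le> C * t powr q * \<Phi> s"
    using assms(1) unfolding U_union_def U_class_def by blast
  show ?thesis
  proof (rule that[of "max 1 (C * K powr q)"])
    fix s :: real assume "s \<ge> 0"
    then show "\<Phi> (K * s) \<le> max 1 (C * K powr q) * \<Phi> s"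
    proof (cases "s = 0")
      case False
      with \<open>s \<ge> 0\<close> have "\<Phi> (K * s) \<le> C * K powr q * \<Phi> s"
        using C[of s K] assms(2) by (simp add: mult.commute)
      also have "\<dots> \<le> max 1 (C * K powr q) * \<Phi> s"
        using nonneg[OF \<open>s \<ge> 0\<close>] by (intro mult_right_mono) auto
      finally show ?thesis .
    qed simp
  qed simp
qed

text \<open>Membership asks for a finite integral of \<open>f\<close> itself, not of a multiple, so
  the division by \<open>K\<close> has to be undone by doubling.\<close>

lemma (in young_function) bergman_orliczI:
  assumes U: "U_union \<Phi>" and K: "K > 0" and hol: "f holomorphic_on upper_half"
    and le1: "orlicz_int \<Phi> \<gamma> (\<lambda>z. f z / complex_of_real K) \<le> 1"
  shows "f \<in> bergman_orlicz \<Phi> \<gamma>"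
proof -
  let ?g = "\<lambda>z. f z / complex_of_real K"
  obtain L where L: "L > 0" "\<And>s. s \<ge> 0 \<Longrightarrow> \<Phi> (max 1 K * s) \<le> L * \<Phi> s"
    by (rule doubling_imp[OF U, of "max 1 K"]) auto
  have cont: "continuous_on upper_half f" "continuous_on upper_half ?g"
    by (intro holomorphic_on_imp_continuous_on hol holomorphic_upper_half_divide)+
  have "\<Phi> (cmod (f z)) * Im z powr \<gamma> \<le> L * (\<Phi> (cmod (?g z)) * Im z powr \<gamma>)" for z
  proof -
    have "\<Phi> (cmod (f z)) \<le> \<Phi> (max 1 K * cmod (?g z))"
      using K by (intro mono) (auto simp: norm_divide field_simps intro!: mult_right_mono)
    also have "\<dots> \<le> L * \<Phi> (cmod (?g z))" by (rule L) simp
    finally have "\<Phi> (cmod (f z)) * Im z powr \<gamma> \<le> L * \<Phi> (cmod (?g z)) * Im z powr \<gamma>"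
      by (rule mult_right_mono) simp
    then show ?thesis by (simp only: mult.assoc)
  qed
  then have "ennreal (\<Phi> (cmod (f z)) * Im z powr \<gamma>) \<le> ennreal L * ennreal (\<Phi> (cmod (?g z)) * Im z powr \<gamma>)" for z
    unfolding ennreal_mult'[OF less_imp_le[OF L(1)], symmetric] by (rule ennreal_leI)
  then have "orlicz_int \<Phi> \<gamma> f \<le> ennreal L * orlicz_int \<Phi> \<gamma> ?g"
    unfolding orlicz_int_eq[OF cont(1)] orlicz_int_eq[OF cont(2)]
    by (subst nn_integral_cmult[symmetric])
       (auto split: split_indicator intro!: orlicz_integrand_measurable[OF cont(2)] nn_integral_mono)
  also have "\<dots> \<le> ennreal L * 1" by (intro mult_left_mono le1) simp
  also have "\<dots> < \<infinity>" by simp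
  finally show ?thesis using hol by (simp add: bergman_orlicz_def)
qed

lemma embedding_sufficient:
  assumes y1: "young_function \<Phi>1" and y2: "young_function \<Phi>2"
    and U: "U_union \<Phi>2"
    and ratio: "mono_on {0<..} (\<lambda>t. \<Phi>2 t / \<Phi>1 t)"
    and \<alpha>: "\<alpha> > -2" and C: "C > 0"
    and inv: "\<And>t. t > 0 \<Longrightarrow> gf_inv \<Phi>1 (t powr (2 + \<alpha>)) \<le> gf_inv \<Phi>2 (C * t powr (2 + \<beta>))"
  shows "cont_embeds \<Phi>1 \<alpha> \<Phi>2 \<beta>"
proof -
  interpret A: young_function \<Phi>1 by fact
  interpret B: young_function \<Phi>2 by fact
  obtain K where K: "K > 0"
    "\<And>f. f holomorphic_on upper_half \<Longrightarrow> orlicz_int \<Phi>1 \<alpha> f \<le> 1 \<Longrightarrow>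
       orlicz_int \<Phi>2 \<beta> (\<lambda>z. f z / complex_of_real K) \<le> 1"
    using orlicz_int_transfer[OF y1 y2 ratio \<alpha> C inv] by metis
  \<comment> \<open>For every r above the norm, f / r lies in the unit ball of the first space, and
    dividing further by \<open>K\<close> puts it into that of the second.\<close>
  have *: "orlicz_int \<Phi>2 \<beta> (\<lambda>z. f z / complex_of_real (r * K)) \<le> 1"
    if f: "f \<in> bergman_orlicz \<Phi>1 \<alpha>" and r: "lux_norm \<Phi>1 \<alpha> f < r" for f r
    using K(2)[OF _ A.lux_norm_less_imp[OF f r]] f
    by (simp add: bergman_orlicz_def holomorphic_upper_half_divide)
  have pos: "r > 0" if "f \<in> bergman_orlicz \<Phi>1 \<alpha>" "lux_norm \<Phi>1 \<alpha> f < r" for f r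
    using A.lux_norm_nonneg[OF that(1)] that(2) by simp
  have "f \<in> bergman_orlicz \<Phi>2 \<beta>" if f: "f \<in> bergman_orlicz \<Phi>1 \<alpha>" for f
  proof (rule B.bergman_orliczI[OF U _ _ *[OF f less_add_one]])
    show "(lux_norm \<Phi>1 \<alpha> f + 1) * K > 0"
      using pos[OF f less_add_one] K(1) by simp
    show "f holomorphic_on upper_half" using f by (simp add: bergman_orlicz_def)
  qed
  moreover have "lux_norm \<Phi>2 \<beta> f \<le> K * lux_norm \<Phi>1 \<alpha> f" if f: "f \<in> bergman_orlicz \<Phi>1 \<alpha>" for f
  proof -
    \<comment> \<open>Letting r decrease to the norm also covers functions of norm 0.\<close>
    have "lux_norm \<Phi>2 \<beta> f / K \<le> r" if r: "lux_norm \<Phi>1 \<alpha> f < r" for r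
      using B.lux_norm_le[OF _ *[OF f r]] pos[OF f r] K(1) by (simp add: divide_le_eq)
    then have "lux_norm \<Phi>2 \<beta> f / K \<le> lux_norm \<Phi>1 \<alpha> f"
      by (rule dense_ge)
    then show ?thesis using K(1) by (simp add: divide_le_eq mult.commute)
  qed
  ultimately show ?thesis unfolding cont_embeds_def by blast
qed

lemma embedding_necessary:
  assumes y1: "young_function \<Phi>1" and y2: "young_function \<Phi>2"
    and U: "U_union \<Phi>2" and \<alpha>: "\<alpha> > -1"
    and embeds: "cont_embeds \<Phi>1 \<alpha> \<Phi>2 \<beta>"
  obtains C where "C > 0"
    "\<And>t. t > 0 \<Longrightarrow> gf_inv \<Phi>1 (t powr (2 + \<alpha>)) \<le> gf_inv \<Phi>2 (C * t powr (2 + \<beta>))"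
proof -
  interpret A: young_function \<Phi>1 by fact
  interpret B: young_function \<Phi>2 by fact
  obtain m :: nat and B0 where B0: "B0 > 0"
    "\<And>v. v > 0 \<Longrightarrow> (\<integral>\<^sup>+ z. ennreal ((v / cmod (z + \<i> * complex_of_real v)) ^ m * Im z powr \<alpha>) * indicator upper_half z \<partial>lborel)
       \<le> ennreal (B0 * v powr (2 + \<alpha>))"
    using kernel_integral_bound[OF \<alpha>] by blast
  obtain c where c: "c > 0"
    "\<And>\<Phi> f z. young_function \<Phi> \<Longrightarrow> f holomorphic_on upper_half \<Longrightarrow> orlicz_int \<Phi> \<beta> f \<le> 1 \<Longrightarrow>
       Im z > 0 \<Longrightarrow> \<Phi> (cmod (f z) / 32) \<le> c * Im z powr - (2 + \<beta>)"
    using pointwise_estimate[of \<beta>] by blast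
  obtain C' where C': "\<And>f. f \<in> bergman_orlicz \<Phi>1 \<alpha> \<Longrightarrow> lux_norm \<Phi>2 \<beta> f \<le> C' * lux_norm \<Phi>1 \<alpha> f"
    and sub: "bergman_orlicz \<Phi>1 \<alpha> \<subseteq> bergman_orlicz \<Phi>2 \<beta>"
    using embeds unfolding cont_embeds_def by blast
  define B1 where "B1 = max 1 B0"
  \<comment> \<open>\<open>B1\<close> will bound the norms of the test functions. The maximum allows
    for a negative \<open>C'\<close>, and the added 1 gives the strict inequality that
    \<open>lux_norm_less_imp\<close> asks for.\<close>
  define K where "K = max 0 C' * B1 + 1"
  have B1: "B1 \<ge> 1" "B1 \<ge> B0" by (simp_all add: B1_def)
  have K: "K \<ge> 1" using B1 by (simp add: K_def)
  have M: "2 ^ m * K * 32 \<ge> 1"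
    using mult_mono[of 1 "2 ^ m" 1 K] K by simp
  \<comment> \<open>The dilation collects every loss: 2^m from evaluating the kernel at \<i>v,
    \<open>K\<close> from the norm, and 32 from the pointwise estimate.\<close>
  obtain L where L: "L > 0" "\<And>s. s \<ge> 0 \<Longrightarrow> \<Phi>2 (2 ^ m * K * 32 * s) \<le> L * \<Phi>2 s"
    using B.doubling_imp[OF U M] by blast
  show ?thesis
  proof (rule that[of "L * c"])
    show "L * c > 0" using L c by simp
    fix t :: real assume t: "t > 0"
    define v where "v = 1 / t"
    have v: "v > 0" using t by (simp add: v_def)
    define a where "a = gf_inv \<Phi>1 (t powr (2 + \<alpha>))"
    have a: "a > 0" "\<Phi>1 a = t powr (2 + \<alpha>)"
      using t by (simp_all add: a_def A.gf_inv_pos)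
    define f where "f = (\<lambda>z. complex_of_real a * (complex_of_real v / (z + \<i> * complex_of_real v)) ^ m)"
    have nz: "z + \<i> * complex_of_real v \<noteq> 0" if "z \<in> upper_half" for z
      using that v by (auto simp: upper_half_def complex_eq_iff)
    have hol: "f holomorphic_on upper_half"
      unfolding f_def using nz by (intro holomorphic_intros) auto
    have cont: "continuous_on upper_half f"
      using hol by (rule holomorphic_on_imp_continuous_on)
    have norm_f: "cmod (f z) = (v / cmod (z + \<i> * complex_of_real v)) ^ m * a" for z
      using a v by (simp add: f_def norm_mult norm_power norm_divide)
    let ?k = "\<lambda>z. ennreal ((v / cmod (z + \<i> * complex_of_real v)) ^ m * Im z powr \<alpha>) * indicator upper_half z"
    have "orlicz_int \<Phi>1 \<alpha> f \<le> (\<integral>\<^sup>+ z. ennreal (t powr (2 + \<alpha>)) * ?k z \<partial>lborel)"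
      unfolding A.orlicz_int_eq[OF cont]
    proof (intro nn_integral_mono)
      fix z
      let ?q = "v / cmod (z + \<i> * complex_of_real v)"
      show "ennreal (\<Phi>1 (cmod (f z)) * Im z powr \<alpha>) * indicator upper_half z \<le> ennreal (t powr (2 + \<alpha>)) * ?k z"
      proof (cases "Im z > 0")
        case True
        have "v \<le> cmod (z + \<i> * complex_of_real v)"
          using True abs_Im_le_cmod[of "z + \<i> * complex_of_real v"] by simp
        with v have q: "0 \<le> ?q" "?q \<le> 1" by (auto simp: divide_le_eq)
        \<comment> \<open>As \<open>?q\<close> is at most 1, its power leaves \<Phi>1 by
          \<open>scale_le\<close>, and only the kernel integral remains.\<close>
        then have "\<Phi>1 (cmod (f z)) \<le> ?q ^ m * \<Phi>1 a"
          unfolding norm_f using a by (intro A.scale_le power_le_one) auto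
        then have "\<Phi>1 (cmod (f z)) * Im z powr \<alpha> \<le> ?q ^ m * t powr (2 + \<alpha>) * Im z powr \<alpha>"
          unfolding a by (rule mult_right_mono) simp
        also have "\<dots> = t powr (2 + \<alpha>) * (?q ^ m * Im z powr \<alpha>)" by (simp only: mult_ac)
        finally have "ennreal (\<Phi>1 (cmod (f z)) * Im z powr \<alpha>) \<le> ennreal (t powr (2 + \<alpha>)) * ennreal (?q ^ m * Im z powr \<alpha>)"
          by (subst ennreal_mult'[symmetric]) (auto intro: ennreal_leI)
        with True show ?thesis by (simp add: upper_half_def)
      qed (simp add: upper_half_def)
    qed
    also have "\<dots> = ennreal (t powr (2 + \<alpha>)) * (\<integral>\<^sup>+ z. ?k z \<partial>lborel)"
      by (rule nn_integral_cmult) measurable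
    also have "\<dots> \<le> ennreal (t powr (2 + \<alpha>)) * ennreal (B0 * v powr (2 + \<alpha>))"
      by (intro mult_left_mono B0 v) simp
    also have "\<dots> = ennreal B0"
    proof -
      have "t powr (2 + \<alpha>) * v powr (2 + \<alpha>) = 1"
        using t by (simp add: v_def powr_mult[symmetric])
      then show ?thesis by (simp add: ennreal_mult'[symmetric] mult.left_commute)
    qed
    finally have f_int: "orlicz_int \<Phi>1 \<alpha> f \<le> ennreal B0" .
    then have f_in: "f \<in> bergman_orlicz \<Phi>1 \<alpha>"
      using hol by (simp add: bergman_orlicz_def order_le_less_trans)
    have "orlicz_int \<Phi>1 \<alpha> (\<lambda>z. f z / complex_of_real B1) \<le> ennreal (1 / B1) * orlicz_int \<Phi>1 \<alpha> f"
      by (intro A.orlicz_int_divide_le hol B1)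
    also have "\<dots> \<le> ennreal (1 / B1) * ennreal B0"
      by (intro mult_left_mono f_int) simp
    also have "\<dots> = ennreal (B0 / B1)"
      using B1 by (simp add: ennreal_mult'[symmetric])
    also have "\<dots> \<le> ennreal 1"
      using B1 by (intro ennreal_leI) (simp add: divide_le_eq)
    finally have "lux_norm \<Phi>1 \<alpha> f \<le> B1"
      using B1 by (intro A.lux_norm_le) auto
    moreover have "lux_norm \<Phi>1 \<alpha> f \<ge> 0" by (rule A.lux_norm_nonneg[OF f_in])
    ultimately have "C' * lux_norm \<Phi>1 \<alpha> f \<le> max 0 C' * B1"
      by (intro mult_mono) auto
    with C'[OF f_in] have "lux_norm \<Phi>2 \<beta> f < K" by (simp add: K_def)
    with f_in sub have "orlicz_int \<Phi>2 \<beta> (\<lambda>z. f z / complex_of_real K) \<le> 1"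
      by (intro B.lux_norm_less_imp) auto
    then have "\<Phi>2 (cmod (f (\<i> * complex_of_real v) / complex_of_real K) / 32) \<le> c * v powr - (2 + \<beta>)"
      using c(2)[OF y2 holomorphic_upper_half_divide[OF hol], of K "\<i> * complex_of_real v"] v by simp
    \<comment> \<open>At z = \<i>v the denominator has modulus 2 v, so the kernel equals
      2^-m.\<close>
    also have "cmod (f (\<i> * complex_of_real v) / complex_of_real K) / 32 = a / (2 ^ m * K * 32)"
    proof -
      have "cmod (\<i> * complex_of_real v + \<i> * complex_of_real v) = 2 * v"
        using v by (simp add: norm_mult flip: mult_2)
      then show ?thesis
        using v K by (simp add: norm_divide norm_f power_one_over)
    qed
    also have "v powr - (2 + \<beta>) = t powr (2 + \<beta>)"
      using t by (simp add: v_def powr_minus_divide powr_divide del: minus_add_distrib)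
    finally have "\<Phi>2 (a / (2 ^ m * K * 32)) \<le> c * t powr (2 + \<beta>)" .
    then have "L * \<Phi>2 (a / (2 ^ m * K * 32)) \<le> L * c * t powr (2 + \<beta>)"
      using L(1) by simp
    moreover have "\<Phi>2 a \<le> L * \<Phi>2 (a / (2 ^ m * K * 32))"
      using L(2)[of "a / (2 ^ m * K * 32)"] a K by simp
    ultimately have "\<Phi>2 a \<le> L * c * t powr (2 + \<beta>)" by simp
    then show "gf_inv \<Phi>1 (t powr (2 + \<alpha>)) \<le> gf_inv \<Phi>2 (L * c * t powr (2 + \<beta>))"
      unfolding a_def[symmetric] using a L c by (subst B.le_gf_inv_iff) auto
  qed
qed

section \<open>Positivity away from the origin\<close>

lemma growth_function_obtain_pos:
  assumes "growth_function \<Phi>"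
  obtains t where "t > 0" "\<Phi> t > 0"
proof -
  \<comment> \<open>That \<Phi> vanishes at 0 is not yet available; a value exceeding |\<Phi>(0)| is
    positive and cannot be attained at 0.\<close>
  have "\<exists>t\<ge>0. \<Phi> t = \<bar>\<Phi> 0\<bar> + 1"
  proof -
    have "\<bar>\<Phi> 0\<bar> + 1 \<in> \<Phi> ` {0..}"
      using assms by (simp add: growth_function_def)
    then show ?thesis by auto
  qed
  then obtain t where t: "t \<ge> 0" "\<Phi> t = \<bar>\<Phi> 0\<bar> + 1" by auto
  moreover have "t \<noteq> 0" using t by auto
  ultimately show ?thesis by (intro that[of t]) auto
qed

lemma growth_function_nonneg: "growth_function \<Phi> \<Longrightarrow> t \<ge> 0 \<Longrightarrow> \<Phi> t \<ge> 0"
  unfolding growth_function_def by (metis atLeast_iff imageI)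

text \<open>A zero at some s > 0 would spread to all larger arguments by the growth bound,
  contradicting surjectivity.\<close>

lemma young_function_U_union:
  assumes "growth_function \<Phi>" "convex_on {0..} \<Phi>" "U_union \<Phi>"
  shows "young_function \<Phi>"
proof
  fix s :: real assume s: "s > 0"
  obtain q C where C: "\<And>s t. s > 0 \<Longrightarrow> t \<ge> 1 \<Longrightarrow> \<Phi> (s * t) \<le> C * t powr q * \<Phi> s"
    using assms(3) unfolding U_union_def U_class_def by blast
  obtain t where t: "t > 0" "\<Phi> t > 0" using growth_function_obtain_pos[OF assms(1)] .
  \<comment> \<open>The maximum keeps the dilation factor at least 1 while s times it still reaches
    \<open>t\<close>.\<close>
  have "\<Phi> t \<le> \<Phi> (s * max 1 (t / s))"
    using assms(1) s t unfolding growth_function_def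
    by (intro mono_onD[of "{0..}" \<Phi>]) (auto simp: max_def field_simps)
  also have "\<dots> \<le> C * max 1 (t / s) powr q * \<Phi> s" using s by (intro C) auto
  finally have "\<Phi> s \<noteq> 0" using t by auto
  with growth_function_nonneg[OF assms(1), of s] s show "\<Phi> s > 0" by auto
qed (use assms in auto)

text \<open>The same propagation of zeros, now by iterating the doubling inequality for \<Phi> until
  2^n s passes a point where \<Phi> is positive.\<close>

lemma young_function_nabla2:
  assumes "growth_function \<Phi>" "convex_on {0..} \<Phi>" "nabla2 \<Phi>"
  shows "young_function \<Phi>"
proof
  fix s :: real assume s: "s > 0"
  obtain K :: real where K: "K > 1" "\<And>t. t \<ge> 0 \<Longrightarrow> \<Phi> (2 * t) \<le> K * \<Phi> t"
    using assms(3) by (auto simp: nabla2_def Delta2_def)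
  obtain t where t: "t > 0" "\<Phi> t > 0" using growth_function_obtain_pos[OF assms(1)] .
  have pow: "\<Phi> (2 ^ n * s) \<le> K ^ n * \<Phi> s" for n
  proof (induction n)
    case (Suc n)
    have "\<Phi> (2 ^ Suc n * s) \<le> K * \<Phi> (2 ^ n * s)"
      using K(2)[of "2 ^ n * s"] s by (simp add: mult.assoc)
    also have "\<dots> \<le> K * (K ^ n * \<Phi> s)"
      using K(1) Suc by (intro mult_left_mono) auto
    finally show ?case by simp
  qed simp
  obtain n where n: "t / s < 2 ^ n" using real_arch_pow[of 2 "t / s"] by auto
  have "\<Phi> t \<le> \<Phi> (2 ^ n * s)"
    using assms(1) s t n unfolding growth_function_def
    by (intro mono_onD[of "{0..}" \<Phi>]) (auto simp: field_simps)
  also have "\<dots> \<le> K ^ n * \<Phi> s" by (rule pow)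
  finally have "\<Phi> s \<noteq> 0" using t by auto
  with growth_function_nonneg[OF assms(1), of s] s show "\<Phi> s > 0" by auto
qed (use assms in auto)

theorem theorem2p4:
  fixes \<Phi>1 \<Phi>2 :: "real \<Rightarrow> real" and \<alpha> \<beta> :: real
  assumes "growth_function \<Phi>1" and "growth_function \<Phi>2"
    and "convex_on {0..} \<Phi>1" and "convex_on {0..} \<Phi>2"
    and "C1_on_nonneg \<Phi>1" and "C1_on_nonneg \<Phi>2"
    and "U_union \<Phi>2"
    and "\<alpha> > -1" and "\<beta> > -1"
    and "nabla2 \<Phi>1"
    and "mono_on {0<..} (\<lambda>t. \<Phi>2 t / \<Phi>1 t)"
  shows "cont_embeds \<Phi>1 \<alpha> \<Phi>2 \<beta> \<longleftrightarrow>
         (\<exists>C>0. \<forall>t>0. gf_inv \<Phi>1 (t powr (2 + \<alpha>)) \<le> gf_inv \<Phi>2 (C * t powr (2 + \<beta>)))"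
proof -
  have y: "young_function \<Phi>1" "young_function \<Phi>2"
    using assms by (auto intro: young_function_nabla2 young_function_U_union)
  show ?thesis
  proof
    assume "cont_embeds \<Phi>1 \<alpha> \<Phi>2 \<beta>"
    then show "\<exists>C>0. \<forall>t>0. gf_inv \<Phi>1 (t powr (2 + \<alpha>)) \<le> gf_inv \<Phi>2 (C * t powr (2 + \<beta>))"
      by (rule embedding_necessary[OF y assms(7,8)]) blast
  next
    assume "\<exists>C>0. \<forall>t>0. gf_inv \<Phi>1 (t powr (2 + \<alpha>)) \<le> gf_inv \<Phi>2 (C * t powr (2 + \<beta>))"
    then obtain C where C: "C > 0"
      "\<And>t. t > 0 \<Longrightarrow> gf_inv \<Phi>1 (t powr (2 + \<alpha>)) \<le> gf_inv \<Phi>2 (C * t powr (2 + \<beta>))" by blast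
    show "cont_embeds \<Phi>1 \<alpha> \<Phi>2 \<beta>"
      by (rule embedding_sufficient[OF y assms(7,11) _ C]) (use assms(8) in simp)
  qed
qed

end
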